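(* Let $G$ be a graph with $n$ vertices and $m\ge 1$ edges, maximum degree $\triangle$ and minimum degree $\delta$. Then $$\delta^2\le \frac{HM_1(G)}{4m}\le \triangle^2.$$ The left equality holds if and only if $G$ is $\delta$-regular, and the right equality holds if and only if $G$ is $\triangle$-regular.
   Context: Graphs are finite, without loops or multiple edges (not assumed connected). For a vertex $u$, $d(u)$ is its degree; $\triangle$ and $\delta$ are the maximum and minimum vertex degree of $G$. For an edge $e=uv$ the edge degree is $d(e)=d(u)+d(v)$. The first hyper-Zagreb index is $HM_1(G)=\sum_{e\in E(G)}d(e)^2$. A graph is $r$-regular if every vertex has degree $r$.
   Formalization: The right equality characterization is stated only for graphs with no isolated vertices; without this it is false: one edge plus an isolated vertex has HM_1/(4m) = 1 = Δ² but is not 1-regular. *)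

theory Defs
  imports Complex_Main
begin

text \<open>
  A graph is a finite vertex set \<open>V\<close> with a set \<open>E\<close> of two-element subsets of \<open>V\<close>;
  this excludes loops and multiple edges. Connectedness is not required, and
  isolated vertices are allowed.
\<close>

definition simple_graph :: "'a set \<Rightarrow> 'a set set \<Rightarrow> bool" where
  "simple_graph V E \<longleftrightarrow> finite V \<and> (\<forall>e\<in>E. e \<subseteq> V \<and> card e = 2)"

definition vdegree :: "'a set set \<Rightarrow> 'a \<Rightarrow> nat" where
  "vdegree E u = card {e \<in> E. u \<in> e}"

text \<open>The extremal degrees are only meaningful for a finite nonempty vertex set.\<close>

definition max_degree :: "'a set \<Rightarrow> 'a set set \<Rightarrow> nat" where
  "max_degree V E = Max (vdegree E ` V)"

definition min_degree :: "'a set \<Rightarrow> 'a set set \<Rightarrow> nat" where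
  "min_degree V E = Min (vdegree E ` V)"

text \<open>For an edge \<open>{u, v}\<close> with \<open>u \<noteq> v\<close> this is \<open>vdegree E u + vdegree E v\<close>.\<close>

definition edge_degree :: "'a set set \<Rightarrow> 'a set \<Rightarrow> nat" where
  "edge_degree E e = (\<Sum>u\<in>e. vdegree E u)"

definition hyper_zagreb1 :: "'a set set \<Rightarrow> nat" where
  "hyper_zagreb1 E = (\<Sum>e\<in>E. (edge_degree E e)\<^sup>2)"

definition regular_graph :: "nat \<Rightarrow> 'a set \<Rightarrow> 'a set set \<Rightarrow> bool" where
  "regular_graph r V E \<longleftrightarrow> (\<forall>u\<in>V. vdegree E u = r)"

end

theory Submission
  imports Defs
begin

text \<open>
  Replacing every vertex degree in \<open>hyper_zagreb1 E\<close> by a constant \<open>r\<close> gives \<open>4 * m * r\<^sup>2\<close>, so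
  both bounds are instances of monotonicity of \<open>w \<mapsto> (\<Sum>e\<in>E. (\<Sum>u\<in>e. w u)\<^sup>2)\<close>. This map
  is strictly monotone in the weights of the covered vertices, so equality forces every
  non-isolated vertex to have degree \<open>r\<close>. If \<open>r\<close> is the minimum degree, then \<open>r > 0\<close> because
  the ends of an edge have positive degree, and hence there are no isolated vertices.
\<close>

lemma sum_square_sum_mono:
  fixes w w' :: "'a \<Rightarrow> nat"
  assumes "\<And>u. u \<in> \<Union>E \<Longrightarrow> w u \<le> w' u"
  shows "(\<Sum>e\<in>E. (\<Sum>u\<in>e. w u)\<^sup>2) \<le> (\<Sum>e\<in>E. (\<Sum>u\<in>e. w' u)\<^sup>2)"
  using assms by (intro sum_mono power_mono) auto

text \<open>Termwise ordered sums that agree must agree term by term. This is used twice: over the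
  edges it equates the squares belonging to one edge at \<open>u\<close>, and, once the squares are
  removed by injectivity on the naturals, over the ends of that edge it equates the weights.\<close>

lemma sum_square_sum_mono_inv:
  fixes w w' :: "'a \<Rightarrow> nat"
  assumes "finite E" "\<And>e. e \<in> E \<Longrightarrow> finite e"
    and le: "\<And>u. u \<in> \<Union>E \<Longrightarrow> w u \<le> w' u"
    and eq: "(\<Sum>e\<in>E. (\<Sum>u\<in>e. w u)\<^sup>2) = (\<Sum>e\<in>E. (\<Sum>u\<in>e. w' u)\<^sup>2)"
    and "u \<in> \<Union>E"
  shows "w u = w' u"
proof -
  obtain e where e: "e \<in> E" "u \<in> e"
    using \<open>u \<in> \<Union>E\<close> by blast
  have "(\<Sum>u\<in>e. w u)\<^sup>2 = (\<Sum>u\<in>e. w' u)\<^sup>2"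
    by (rule sum_mono_inv[OF eq _ e(1) \<open>finite E\<close>]) (auto intro!: power_mono sum_mono le)
  then have sum_eq: "(\<Sum>u\<in>e. w u) = (\<Sum>u\<in>e. w' u)"
    by simp
  show ?thesis
    by (rule sum_mono_inv[OF sum_eq _ e(2)]) (use e assms in auto)
qed

lemma hyper_zagreb1_eq: "hyper_zagreb1 E = (\<Sum>e\<in>E. (\<Sum>u\<in>e. vdegree E u)\<^sup>2)"
  by (simp add: hyper_zagreb1_def edge_degree_def)

text \<open>Each edge has two ends and so contributes \<open>(2 * r)\<^sup>2\<close>.\<close>

lemma sum_square_sum_const:
  fixes r :: nat
  assumes "simple_graph V E"
  shows "(\<Sum>e\<in>E. (\<Sum>u\<in>e. r)\<^sup>2) = 4 * card E * r\<^sup>2"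
  using assms by (simp add: simple_graph_def power_mult_distrib)

lemma simple_graph_finite:
  assumes "simple_graph V E"
  shows "finite V" "finite E" "e \<in> E \<Longrightarrow> finite e"
proof -
  show "finite V" and "e \<in> E \<Longrightarrow> finite e"
    using assms by (auto simp: simple_graph_def intro: finite_subset)
  have "E \<subseteq> Pow V"
    using assms by (auto simp: simple_graph_def)
  then show "finite E"
    using \<open>finite V\<close> finite_subset by blast
qed

lemma Union_edges_subset: "simple_graph V E \<Longrightarrow> \<Union>E \<subseteq> V"
  by (auto simp: simple_graph_def)

text \<open>Finiteness rules out the default value 0 of \<open>card\<close> on an infinite set of
  incident edges.\<close>

lemma vdegree_eq_0_iff:
  assumes "finite E"
  shows "vdegree E u = 0 \<longleftrightarrow> u \<notin> \<Union>E"
  using assms by (auto simp: vdegree_def)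

lemma hyper_zagreb1_regular:
  assumes "simple_graph V E" "regular_graph r V E"
  shows "hyper_zagreb1 E = 4 * card E * r\<^sup>2"
proof -
  have "(\<Sum>e\<in>E. (\<Sum>u\<in>e. vdegree E u)\<^sup>2) = (\<Sum>e\<in>E. (\<Sum>u\<in>e. r)\<^sup>2)"
    using assms Union_edges_subset[OF assms(1)]
    by (intro sum.cong arg_cong[where f = "\<lambda>x. x\<^sup>2"]) (auto simp: regular_graph_def)
  then show ?thesis
    using sum_square_sum_const[OF assms(1)] by (simp add: hyper_zagreb1_eq)
qed

theorem theorem1:
  fixes V :: "'a set" and E :: "'a set set" and n m \<Delta> \<delta> :: nat
  assumes "simple_graph V E"
    and "card V = n" and "card E = m" and "m \<ge> 1"
    and "\<Delta> = max_degree V E" and "\<delta> = min_degree V E"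
  shows "(real \<delta>)\<^sup>2 \<le> real (hyper_zagreb1 E) / (4 * real m)
    \<and> real (hyper_zagreb1 E) / (4 * real m) \<le> (real \<Delta>)\<^sup>2
    \<and> ((real \<delta>)\<^sup>2 = real (hyper_zagreb1 E) / (4 * real m) \<longleftrightarrow> regular_graph \<delta> V E)
    \<and> ((\<forall>u\<in>V. vdegree E u \<noteq> 0) \<longrightarrow>
        (real (hyper_zagreb1 E) / (4 * real m) = (real \<Delta>)\<^sup>2 \<longleftrightarrow> regular_graph \<Delta> V E))"
proof -
  let ?H = "hyper_zagreb1 E"
  note graph = assms(1)
  note fin = simple_graph_finite[OF graph]
  note const = sum_square_sum_const[OF graph, unfolded \<open>card E = m\<close>]
  have low: "\<delta> \<le> vdegree E u" and high: "vdegree E u \<le> \<Delta>" if "u \<in> V" for u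
    using that fin(1) by (simp_all add: assms(5,6) min_degree_def max_degree_def)
  have covered: "u \<in> V" if "u \<in> \<Union>E" for u
    using that Union_edges_subset[OF graph] by blast
  have lower: "4 * m * \<delta>\<^sup>2 \<le> ?H"
    using sum_square_sum_mono[of E "\<lambda>_. \<delta>" "vdegree E"] low covered
    by (simp only: const hyper_zagreb1_eq)
  have upper: "?H \<le> 4 * m * \<Delta>\<^sup>2"
    using sum_square_sum_mono[of E "vdegree E" "\<lambda>_. \<Delta>"] high covered
    by (simp only: const hyper_zagreb1_eq)
  have regular: "?H = 4 * m * r\<^sup>2" if "regular_graph r V E" for r
    using hyper_zagreb1_regular[OF graph that] by (simp add: assms(3))
  have left: "4 * m * \<delta>\<^sup>2 = ?H \<longleftrightarrow> regular_graph \<delta> V E"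
  proof
    assume "4 * m * \<delta>\<^sup>2 = ?H"
    then have eq: "(\<Sum>e\<in>E. (\<Sum>u\<in>e. \<delta>)\<^sup>2) = (\<Sum>e\<in>E. (\<Sum>u\<in>e. vdegree E u)\<^sup>2)"
      by (simp only: const hyper_zagreb1_eq)
    have deg: "\<delta> = vdegree E u" if "u \<in> \<Union>E" for u
      using sum_square_sum_mono_inv[OF fin(2,3) _ eq that] low covered by blast
    \<comment> \<open>An end of any edge has degree \<open>\<delta>\<close> by \<open>deg\<close>,
      and nonzero degree because it is covered.\<close>
    obtain e where "e \<in> E"
      using \<open>m \<ge> 1\<close> \<open>card E = m\<close> by fastforce
    moreover have "e \<noteq> {}"
      using graph \<open>e \<in> E\<close> by (auto simp: simple_graph_def)
    ultimately obtain v where "v \<in> \<Union>E"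
      by blast
    then have "\<delta> \<noteq> 0"
      using deg vdegree_eq_0_iff[OF fin(2)] by metis
    then have "u \<in> \<Union>E" if "u \<in> V" for u
      using low[OF that] vdegree_eq_0_iff[OF fin(2), of u] by linarith
    then show "regular_graph \<delta> V E"
      using deg by (metis regular_graph_def)
  qed (simp add: regular)
  \<comment> \<open>Equality determines the degrees of covered vertices only, and a positive maximum
    degree does not exclude isolated vertices: a single edge plus an isolated vertex attains
    equality with \<open>\<Delta> = 1\<close> but is not regular.\<close>
  have right: "?H = 4 * m * \<Delta>\<^sup>2 \<longleftrightarrow> regular_graph \<Delta> V E" if "\<forall>u\<in>V. vdegree E u \<noteq> 0"
  proof
    assume "?H = 4 * m * \<Delta>\<^sup>2"
    then have eq: "(\<Sum>e\<in>E. (\<Sum>u\<in>e. vdegree E u)\<^sup>2) = (\<Sum>e\<in>E. (\<Sum>u\<in>e. \<Delta>)\<^sup>2)"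
      by (simp only: const hyper_zagreb1_eq)
    have "vdegree E u = \<Delta>" if "u \<in> \<Union>E" for u
      using sum_square_sum_mono_inv[OF fin(2,3) _ eq that] high covered by blast
    then show "regular_graph \<Delta> V E"
      using that vdegree_eq_0_iff[OF fin(2)] by (metis regular_graph_def)
  qed (simp add: regular)
  \<comment> \<open>The factors on the right are ordered as they appear after clearing the
    denominator \<open>4 * real m\<close>, so the quotient bounds turn into the bounds over the
    naturals.\<close>
  have cast: "real (4 * m * r\<^sup>2) = (real r)\<^sup>2 * (4 * real m)" for r
    by simp
  have pos: "4 * real m > 0"
    using \<open>m \<ge> 1\<close> by simp
  have "(real \<delta>)\<^sup>2 \<le> real ?H / (4 * real m)"
    using lower unfolding pos_le_divide_eq[OF pos] cast[symmetric] by (simp only: of_nat_le_iff)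
  moreover have "real ?H / (4 * real m) \<le> (real \<Delta>)\<^sup>2"
    using upper unfolding pos_divide_le_eq[OF pos] cast[symmetric] by (simp only: of_nat_le_iff)
  moreover have "(real \<delta>)\<^sup>2 = real ?H / (4 * real m) \<longleftrightarrow> 4 * m * \<delta>\<^sup>2 = ?H"
    using pos unfolding of_nat_eq_iff[where 'a = real, symmetric] cast
    by (simp only: eq_divide_eq) auto
  moreover have "real ?H / (4 * real m) = (real \<Delta>)\<^sup>2 \<longleftrightarrow> ?H = 4 * m * \<Delta>\<^sup>2"
    using pos unfolding of_nat_eq_iff[where 'a = real, symmetric] cast
    by (simp only: divide_eq_eq) auto
  ultimately show ?thesis
    using left right by blast
qed

end
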